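(* Let $f=h+\overline{g}\in\mathcal{F}_H^0$, where $h(z)=z+\sum_{n=2}^\infty a_nz^n$ and $g(z)=\sum_{n=1}^\infty b_nz^n$ are analytic in $\mathbb{D}$, with $b_1=g'(0)=0$. Then: (i) $|a_n|\le 1/n$ for $n=2,3,\ldots$. Equality holds for some $m\ge 2$ if and only if $f$ is analytic in $\mathbb{D}$ and $f(z)=z+\frac{z^m}{m}$. (ii) $|b_n|\le 1/n$ for $n=2,3,\ldots$. Equality holds for some $m\ge 2$ if and only if $f$ is of the form $f(z)=z+\frac{\overline{z}^{\,m}}{m}$. (iii) $|a_n|^2+|b_n|^2\le 1/n^2$ for $n=2,3,\ldots$. (iv) $|a_n|+|b_n|\le 1/n$ for $n=2,3,\ldots$.
   Context: $\mathbb{D}=\{z\in\mathbb{C}:|z|<1\}$. $\mathcal{F}_H^0$ is the class of all complex-valued harmonic functions $f$ in $\mathbb{D}$ with $f(0)=0$, $f_z(0)=1$, $f_{\bar z}(0)=0$ and $|f_z(z)-1|<1-|f_{\bar z}(z)|$ for all $z\in\mathbb{D}$. Each such $f$ is written as $f=h+\overline{g}$ with $h,g$ analytic in $\mathbb{D}$ and $g(0)=0$; then $f_z=h'$ and $|f_{\bar z}|=|g'|$.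
   Formalization: The equality cases in (i) and (ii) hold only up to a unimodular constant: the extremal functions are z + c z^m/m and z + c z̄^m/m with |c| = 1; as printed (c = 1) the "only if" fails, e.g. for z + i z^m/m. *)

theory Defs
  imports "HOL-Analysis.Analysis"
begin

definition dx :: "(complex \<Rightarrow> complex) \<Rightarrow> complex \<Rightarrow> complex" where
  "dx f z = frechet_derivative f (at z) 1"

definition dy :: "(complex \<Rightarrow> complex) \<Rightarrow> complex \<Rightarrow> complex" where
  "dy f z = frechet_derivative f (at z) \<i>"

text \<open>The Wirtinger derivatives $f_z$ and $f_{\bar z}$.\<close>

definition dz :: "(complex \<Rightarrow> complex) \<Rightarrow> complex \<Rightarrow> complex" where
  "dz f z = (dx f z - \<i> * dy f z) / 2"

definition dzbar :: "(complex \<Rightarrow> complex) \<Rightarrow> complex \<Rightarrow> complex" where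
  "dzbar f z = (dx f z + \<i> * dy f z) / 2"

text \<open>
  Intended for open \<open>S\<close>. \<open>frechet_derivative\<close> is unspecified where a function is not
  (real) differentiable, so differentiability is demanded explicitly; \<open>c2_on\<close> then says that
  \<open>f\<close> is twice continuously differentiable in the real sense.
\<close>

definition c2_on :: "(complex \<Rightarrow> complex) \<Rightarrow> complex set \<Rightarrow> bool" where
  "c2_on f S \<longleftrightarrow>
     (\<forall>z\<in>S. f differentiable (at z) \<and> dx f differentiable (at z) \<and> dy f differentiable (at z)) \<and>
     continuous_on S (dx (dx f)) \<and> continuous_on S (dy (dx f)) \<and>
     continuous_on S (dx (dy f)) \<and> continuous_on S (dy (dy f))"

definition harmonic_on :: "(complex \<Rightarrow> complex) \<Rightarrow> complex set \<Rightarrow> bool" where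
  "harmonic_on f S \<longleftrightarrow> c2_on f S \<and> (\<forall>z\<in>S. dx (dx f) z + dy (dy f) z = 0)"

definition FH0 :: "(complex \<Rightarrow> complex) set" where
  "FH0 = {f. harmonic_on f (ball 0 1) \<and> f 0 = 0 \<and> dz f 0 = 1 \<and> dzbar f 0 = 0 \<and>
             (\<forall>z\<in>ball 0 1. cmod (dz f z - 1) < 1 - cmod (dzbar f z))}"

end

theory Submission
  imports Defs "HOL-Complex_Analysis.Complex_Analysis"
begin

text \<open>
  On the disc the two Wirtinger derivatives of \<^term>\<open>f\<close> are \<^term>\<open>deriv h\<close> and
  \<^term>\<open>cnj \<circ> deriv g\<close>, so membership in the class bounds the total modulus of \<open>h' - 1\<close> and
  \<open>g'\<close> by \<open>1\<close>. For unimodular \<open>\<omega>\<close> the holomorphic function \<open>h' - 1 + \<omega> g'\<close> is therefore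
  bounded by \<open>1\<close>, and so are its Taylor coefficients \<open>n (a\<^sub>n + \<omega> b\<^sub>n)\<close>. Aligning the two
  arguments by the choice of \<open>\<omega>\<close> gives \<open>|a\<^sub>n| + |b\<^sub>n| \<le> 1/n\<close>, which contains all the
  other inequalities.

  For the equality cases, a holomorphic function bounded by \<open>1\<close> on the disc with a Taylor coefficient
  of modulus \<open>1\<close> is a monomial, because it has mean square at most \<open>1\<close> on every circle and
  that coefficient already uses up all of it (\<open>extremal_Taylor_coefficient_rigidity\<close>). If
  \<open>m |a\<^sub>m| = 1\<close>, then \<open>b\<^sub>m = 0\<close> by the inequality, so this applies to both
  \<open>h' - 1 + g'\<close> and \<open>h' - 1 - g'\<close>; adding and subtracting leaves only the coefficient
  \<open>a\<^sub>m\<close> (\<open>derivative_pair.extremal\<close>). The hypotheses are symmetric in \<open>h' - 1\<close> and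
  \<open>g'\<close>, so the same lemma treats \<open>b\<^sub>m\<close>. Conversely, the functions \<open>h\<close> and \<open>g\<close> are
  determined by \<open>f\<close> and \<open>h 0 = 0\<close> (\<open>analytic_part_unique\<close>), so the coefficients can be read off from a
  closed form of \<open>f\<close>.
\<close>

section \<open>Wirtinger derivatives of a harmonic function\<close>

lemma Wirtinger_derivatives_decomposition:
  assumes "open S" "z \<in> S" "h holomorphic_on S" "g holomorphic_on S"
    and f: "\<And>w. w \<in> S \<Longrightarrow> f w = h w + cnj (g w)"
  shows "dz f z = deriv h z" "dzbar f z = cnj (deriv g z)"
proof -
  have "((\<lambda>w. h w + cnj (g w)) has_derivative (\<lambda>v. deriv h z * v + cnj (deriv g z * v))) (at z)"
    using assms(1-4)
    by (intro has_derivative_add bounded_linear.has_derivative[OF bounded_linear_cnj])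
      (auto intro: holomorphic_derivI has_field_derivative_imp_has_derivative)
  then have "(f has_derivative (\<lambda>v. deriv h z * v + cnj (deriv g z * v))) (at z)"
    by (rule has_derivative_transform_within_open[OF _ assms(1,2)]) (simp add: f)
  then have "frechet_derivative f (at z) = (\<lambda>v. deriv h z * v + cnj (deriv g z * v))"
    by (rule frechet_derivative_at[symmetric])
  then show "dz f z = deriv h z" "dzbar f z = cnj (deriv g z)"
    by (simp_all add: dz_def dzbar_def dx_def dy_def algebra_simps)
qed

text \<open>
  The derivative of the analytic part is \<^term>\<open>dz\<close> of the sum, so it is the same in both
  decompositions, and the values at \<open>0\<close> fix the additive constant.
\<close>

lemma analytic_part_unique:
  assumes "convex S" "open S" "0 \<in> S"
    and "h holomorphic_on S" "g holomorphic_on S" "k holomorphic_on S" "l holomorphic_on S"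
    and eq: "\<And>w. w \<in> S \<Longrightarrow> h w + cnj (g w) = k w + cnj (l w)"
    and "h 0 = k 0" "z \<in> S"
  shows "h z = k z" "g z = l z"
proof -
  have "deriv h w = deriv k w" if "w \<in> S" for w
  proof -
    have "dz (\<lambda>w. h w + cnj (g w)) w = deriv h w"
      by (rule Wirtinger_derivatives_decomposition(1)[where S=S and g=g]) (use assms that in auto)
    moreover have "dz (\<lambda>w. h w + cnj (g w)) w = deriv k w"
      by (rule Wirtinger_derivatives_decomposition(1)[where S=S and g=l]) (use assms that in auto)
    ultimately show ?thesis by simp
  qed
  then have "((\<lambda>w. h w - k w) has_field_derivative 0) (at w within S)" if "w \<in> S" for w
    using DERIV_diff[OF holomorphic_derivI[OF assms(4,2) that] holomorphic_derivI[OF assms(6,2) that]] that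
    by (metis diff_self has_field_derivative_at_within)
  then obtain c where "\<And>w. w \<in> S \<Longrightarrow> h w - k w = c"
    using has_field_derivative_zero_constant[OF assms(1)] by metis
  then show *: "h z = k z"
    using assms(3,9,10) by (metis diff_self eq_iff_diff_eq_0)
  show "g z = l z" using eq[OF assms(10)] * by simp
qed

section \<open>Taylor coefficients of bounded functions\<close>

lemma Taylor_coefficient_eq_powser:
  fixes F :: "complex \<Rightarrow> complex"
  assumes "\<And>z. z \<in> ball 0 1 \<Longrightarrow> (\<lambda>n. c n * z ^ n) sums F z"
  shows "(deriv ^^ n) F 0 / fact n = c n"
proof -
  have "F has_fps_expansion Abs_fps c"
    by (rule has_fps_expansionI, rule eventually_nhds_in_open[of "ball 0 1", THEN eventually_mono])
      (use assms in auto)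
  then show ?thesis using fps_nth_fps_expansion by fastforce
qed

lemma powser_unique:
  fixes F :: "complex \<Rightarrow> complex"
  assumes "\<And>z. z \<in> ball 0 1 \<Longrightarrow> (\<lambda>n. c n * z ^ n) sums F z"
    and "\<And>z. z \<in> ball 0 1 \<Longrightarrow> (\<lambda>n. d n * z ^ n) sums F z"
  shows "c = d"
  using Taylor_coefficient_eq_powser[of c F, OF assms(1)] Taylor_coefficient_eq_powser[of d F, OF assms(2)]
  by (intro ext) metis

lemma monomial_sums:
  fixes c z :: complex
  shows "(\<lambda>n. (if n = m then c else 0) * z ^ n) sums (c * z ^ m)"
  using sums_single[of m "\<lambda>n. c * z ^ n"] by (simp add: if_distrib if_distribR cong: if_cong)

text \<open>
  The limit \<open>r \<rightarrow> 1\<close> that turns estimates on the circle of radius \<open>r\<close> into estimates on the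
  coefficients.
\<close>

lemma le_if_less_one_power_bound:
  fixes x y :: real
  assumes "\<And>r. 0 < r \<Longrightarrow> r < 1 \<Longrightarrow> r ^ n * x \<le> y + (1 - r ^ k) * z"
  shows "x \<le> y"
proof -
  have "((\<lambda>r. y + (1 - r ^ k) * z - r ^ n * x) \<longlongrightarrow> y + (1 - 1 ^ k) * z - 1 ^ n * x) (at_left (1::real))"
    by (intro tendsto_intros)
  moreover have "\<forall>\<^sub>F r in at_left (1::real). 0 \<le> y + (1 - r ^ k) * z - r ^ n * x"
    using eventually_at_left_real[of 0 "1::real"] by (auto elim!: eventually_mono dest: assms)
  ultimately have "0 \<le> y + (1 - 1 ^ k) * z - 1 ^ n * x"
    by (rule tendsto_lowerbound) simp
  then show ?thesis by simp
qed

lemma bounded_Taylor_coefficient_le_one: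
  assumes F: "F holomorphic_on ball 0 1" and le: "\<And>z. z \<in> ball 0 1 \<Longrightarrow> cmod (F z) \<le> 1"
  shows "cmod ((deriv ^^ n) F 0 / fact n) \<le> 1"
proof (rule le_if_less_one_power_bound[where n=n and k=0 and z=0])
  fix r :: real assume r: "0 < r" "r < 1"
  have "cmod ((deriv ^^ n) F 0) \<le> fact n * 1 / r ^ n"
    using r by (intro Cauchy_inequality holomorphic_on_imp_continuous_on holomorphic_on_subset[OF F] le)
      (auto simp: dist_norm)
  then show "r ^ n * cmod ((deriv ^^ n) F 0 / fact n) \<le> 1 + (1 - r ^ 0) * 0"
    using r by (simp add: norm_divide field_simps)
qed

text \<open>
  This is Cauchy's formula for the \<open>n\<close>-th derivative: on the circle, \<open>cnj w ^ n\<close> equals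
  \<open>r ^ (2 * n) / w ^ n\<close>, and the parametrisation contributes the factor \<open>2 \<pi> \<i> w\<close>.
  With conjugates in place of negative powers the formula is an inner product with a monomial.
\<close>

lemma circle_mean_eq_Taylor_coefficient:
  assumes F: "F holomorphic_on ball 0 1" and r: "0 < r" "r < 1"
  shows "((\<lambda>t. F (circlepath 0 r t) * cnj (circlepath 0 r t) ^ n) has_integral
           of_real (r ^ (2 * n)) * ((deriv ^^ n) F 0 / fact n)) {0..1}"
proof -
  let ?c = "of_real (r ^ (2 * n)) / (2 * of_real pi * \<i>)"
  have "((\<lambda>u. F u / (u - 0) ^ Suc n) has_contour_integral
          (2 * pi * \<i>) / fact n * (deriv ^^ n) F 0) (circlepath 0 r)"
    using r by (intro Cauchy_has_contour_integral_higher_derivative_circlepath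
        holomorphic_on_imp_continuous_on holomorphic_on_subset[OF F]) auto
  then have "((\<lambda>t. F (circlepath 0 r t) / circlepath 0 r t ^ Suc n *
          vector_derivative (circlepath 0 r) (at t within {0..1})) has_integral
          (2 * pi * \<i>) / fact n * (deriv ^^ n) F 0) {0..1}"
    by (simp add: has_contour_integral_def)
  from has_integral_mult_right[OF this, of ?c]
  have *: "((\<lambda>t. ?c * (F (circlepath 0 r t) / circlepath 0 r t ^ Suc n *
          vector_derivative (circlepath 0 r) (at t within {0..1}))) has_integral
          of_real (r ^ (2 * n)) * ((deriv ^^ n) F 0 / fact n)) {0..1}"
    by (simp add: field_simps)
  show ?thesis
  proof (rule has_integral_eq[OF _ *])
    fix t :: real assume t: "t \<in> {0..1}"
    define w where "w = circlepath 0 r t"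
    have w: "cmod w = r" using r by (simp add: w_def circlepath norm_mult)
    then have w0: "w \<noteq> 0" using r by auto
    have "of_real (r ^ 2) = w * cnj w"
      using w complex_norm_square by metis
    then have pw: "of_real (r ^ (2 * n)) = w ^ n * cnj w ^ n"
      by (metis of_real_power power_mult power_mult_distrib)
    have cancel: "A * B / s * (X / (w * A) * (s * w)) = X * B" if "A \<noteq> 0" "s \<noteq> 0" for A B X s
      using that w0 by (simp add: field_simps)
    have vd: "vector_derivative (circlepath 0 r) (at t within {0..1}) = 2 * of_real pi * \<i> * w"
      using t vector_derivative_circlepath01[of t 0 r] by (simp add: w_def) (simp add: circlepath)
    show "?c * (F (circlepath 0 r t) / circlepath 0 r t ^ Suc n *
          vector_derivative (circlepath 0 r) (at t within {0..1})) =
          F (circlepath 0 r t) * cnj (circlepath 0 r t) ^ n"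
      unfolding vd pw w_def[symmetric] power_Suc by (rule cancel) (use w0 in auto)
  qed
qed

text \<open>
  Let \<open>c\<close> be the extremal coefficient. On the circle of radius \<open>r\<close> the mean of
  \<open>|F - c w^k|^2\<close> is at most \<open>2 - 2 r^(2k)\<close>: expand the square, bound both squared moduli by
  \<open>1\<close>, and evaluate the cross term with the mean value formula. This tends to \<open>0\<close> as
  \<open>r \<rightarrow> 1\<close>, and so does the mean of \<open>|F - c w^k|\<close>, which controls every other coefficient.
  Passing from the mean square to the mean uses
  \<open>x \<le> \<delta>/2 + x\<^sup>2/(2\<delta>)\<close> pointwise, with \<open>\<delta> \<rightarrow> 0\<close> after \<open>r \<rightarrow> 1\<close>, in place of the
  Cauchy-Schwarz inequality for integrals.
\<close>

lemma extremal_Taylor_coefficient_rigidity: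
  assumes F: "F holomorphic_on ball 0 1" and le: "\<And>z. z \<in> ball 0 1 \<Longrightarrow> cmod (F z) \<le> 1"
    and ext: "cmod ((deriv ^^ k) F 0 / fact k) = 1" and "n \<noteq> k"
  shows "(deriv ^^ n) F 0 / fact n = 0"
proof -
  define c where "c = (\<lambda>n. (deriv ^^ n) F 0 / fact n)"
  define D where "D = (\<lambda>w. F w - c k * w ^ k)"
  have D: "D holomorphic_on ball 0 1"
    unfolding D_def by (intro holomorphic_intros F)
  have "(deriv ^^ n) (\<lambda>w. c k * w ^ k) 0 / fact n = (if n = k then c k else 0)"
    by (rule Taylor_coefficient_eq_powser) (rule monomial_sums)
  then have "(deriv ^^ n) (\<lambda>w. c k * w ^ k) 0 = 0" using \<open>n \<noteq> k\<close> by simp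
  moreover have "(deriv ^^ n) D 0 = (deriv ^^ n) F 0 - (deriv ^^ n) (\<lambda>w. c k * w ^ k) 0"
    unfolding D_def by (rule higher_deriv_diff[where S="ball 0 1"]) (auto intro!: holomorphic_intros F)
  ultimately have Dn: "(deriv ^^ n) D 0 / fact n = c n" by (simp add: c_def)
  have small: "cmod (c n) \<le> \<delta> / 2" if \<delta>: "0 < \<delta>" for \<delta>
  proof (rule le_if_less_one_power_bound)
    fix r :: real assume r: "0 < r" "r < 1"
    let ?w = "circlepath 0 r"
    let ?B = "\<lambda>t. \<delta> / 2 + (1 - Re (cnj (c k) * (F (?w t) * cnj (?w t) ^ k))) / \<delta>"
    have iD: "((\<lambda>t. D (?w t) * cnj (?w t) ^ n) has_integral of_real (r ^ (2 * n)) * c n) {0..1}"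
      using circle_mean_eq_Taylor_coefficient[OF D r, of n] by (simp only: Dn)
    have "((\<lambda>t. F (?w t) * cnj (?w t) ^ k) has_integral of_real (r ^ (2 * k)) * c k) {0..1}"
      using circle_mean_eq_Taylor_coefficient[OF F r, of k] by (simp only: c_def)
    then have "((\<lambda>t. Re (cnj (c k) * (F (?w t) * cnj (?w t) ^ k))) has_integral
        Re (cnj (c k) * (of_real (r ^ (2 * k)) * c k))) {0..1}"
      by (intro has_integral_Re has_integral_mult_right)
    moreover have "cnj (c k) * c k = 1"
      using ext complex_norm_square[of "c k"] by (simp add: c_def mult.commute)
    then have "cnj (c k) * (of_real (r ^ (2 * k)) * c k) = of_real (r ^ (2 * k))"
      by (metis mult.left_commute mult.right_neutral)
    ultimately have iR: "((\<lambda>t. Re (cnj (c k) * (F (?w t) * cnj (?w t) ^ k))) has_integral r ^ (2 * k)) {0..1}"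
      by (simp only: Re_complex_of_real)
    have c: "((\<lambda>t. a) has_integral a) {0..1::real}" for a :: real
      using has_integral_const_real[of a 0 1] by simp
    have iB: "(?B has_integral \<delta> / 2 + (1 - r ^ (2 * k)) / \<delta>) {0..1}"
      by (intro has_integral_add has_integral_divide has_integral_diff iR c)
    have "cmod (D (?w t) * cnj (?w t) ^ n) \<le> ?B t" for t
    proof -
      define w where "w = ?w t"
      have w: "cmod w = r" using r by (simp add: w_def circlepath norm_mult)
      have Fw: "cmod (F w) \<le> 1" using w r by (intro le) simp
      have cw: "cmod (c k * w ^ k) \<le> 1"
        using ext r w unfolding norm_mult norm_power c_def by (simp only: mult_1 power_le_one less_imp_le)
      have "(cmod (x - y))\<^sup>2 = (cmod x)\<^sup>2 + (cmod y)\<^sup>2 - 2 * Re (x * cnj y)" for x y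
        unfolding cmod_power2 by (simp add: power2_eq_square algebra_simps)
      from this[of "F w" "c k * w ^ k"] have "(cmod (D w))\<^sup>2 \<le> 1 + 1 - 2 * Re (F w * cnj (c k * w ^ k))"
        using power_le_one[OF norm_ge_zero Fw, of 2] power_le_one[OF norm_ge_zero, of "c k * w ^ k" 2] cw
        unfolding D_def by linarith
      then have D2: "(cmod (D w))\<^sup>2 \<le> 2 * (1 - Re (cnj (c k) * (F w * cnj w ^ k)))"
        by (simp add: mult_ac)
      have "2 * \<delta> * cmod (D w) \<le> \<delta>\<^sup>2 + 2 * (1 - Re (cnj (c k) * (F w * cnj w ^ k)))"
        using D2 sum_squares_bound[of \<delta> "cmod (D w)"] by linarith
      then have "cmod (D w) \<le> \<delta> / 2 + (1 - Re (cnj (c k) * (F w * cnj w ^ k))) / \<delta>"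
        using \<delta> by (simp add: field_simps power2_eq_square)
      moreover have "cmod (D w * cnj w ^ n) \<le> cmod (D w) * 1"
        unfolding norm_mult norm_power complex_mod_cnj w
        using r by (intro mult_left_mono power_le_one) auto
      ultimately show ?thesis by (simp add: w_def)
    qed
    then have "cmod (of_real (r ^ (2 * n)) * c n) \<le> \<delta> / 2 + (1 - r ^ (2 * k)) / \<delta>"
      using integral_norm_bound_integral[of _ "{0..1}" ?B] iD iB
      by (metis (no_types, lifting) has_integral_integrable integral_unique)
    then show "r ^ (2 * n) * cmod (c n) \<le> \<delta> / 2 + (1 - r ^ (2 * k)) * (1 / \<delta>)"
      using r by (simp add: norm_mult norm_power)
  qed
  have "cmod (c n) \<le> 0"
  proof (rule field_le_epsilon)
    fix e :: real assume "0 < e"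
    then show "cmod (c n) \<le> 0 + e" using small[of "2 * e"] by simp
  qed
  then show ?thesis by (simp add: c_def)
qed

section \<open>Pairs of functions with derivatives of total modulus at most one\<close>

lemma unimodular_rotation_norm_add:
  fixes x y :: complex
  obtains \<omega> where "cmod \<omega> = 1" "cmod (x + \<omega> * y) = cmod x + cmod y"
proof (cases "x = 0 \<or> y = 0")
  case True
  then show ?thesis using that[of 1] by auto
next
  case False
  have "x + (sgn x * cnj (sgn y)) * y = sgn x * of_real (cmod x + cmod y)"
    using False complex_norm_square[of y]
    by (simp add: sgn_eq field_simps power2_eq_square)
  then have "cmod (x + (sgn x * cnj (sgn y)) * y) = cmod x + cmod y"
    using False by (simp only: norm_mult norm_of_real) (simp add: norm_sgn)
  then show ?thesis
    using that[of "sgn x * cnj (sgn y)"] False by (simp add: norm_mult norm_sgn)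
qed

lemma deriv_Taylor_coefficient:
  "(deriv ^^ n) (deriv P) 0 / fact n = of_nat (Suc n) * ((deriv ^^ Suc n) P 0 / fact (Suc n))"
  by (simp add: funpow_Suc_right del: funpow.simps of_nat_Suc)

text \<open>
  The situation of the theorem with \<open>p z = h z - z\<close> and \<open>q = g\<close>, stated so that the two functions
  can be exchanged.
\<close>

locale derivative_pair =
  fixes p q :: "complex \<Rightarrow> complex" and \<alpha> \<beta> :: "nat \<Rightarrow> complex"
  assumes p: "p holomorphic_on ball 0 1" and q: "q holomorphic_on ball 0 1"
    and bound: "\<And>z. z \<in> ball 0 1 \<Longrightarrow> cmod (deriv p z) + cmod (deriv q z) \<le> 1"
    and \<alpha>: "\<And>z. z \<in> ball 0 1 \<Longrightarrow> (\<lambda>n. \<alpha> n * z ^ n) sums p z"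
    and \<beta>: "\<And>z. z \<in> ball 0 1 \<Longrightarrow> (\<lambda>n. \<beta> n * z ^ n) sums q z"
begin

lemma swap: "derivative_pair q p \<beta> \<alpha>"
  using p q bound \<alpha> \<beta> by unfold_locales (auto simp: add.commute)

context
  fixes \<omega> :: complex
  assumes \<omega>: "cmod \<omega> = 1"
begin

definition rotated_sum where "rotated_sum = (\<lambda>z. p z + \<omega> * q z)"

lemma rotated_sum_holomorphic: "rotated_sum holomorphic_on ball 0 1"
  unfolding rotated_sum_def by (intro holomorphic_intros p q)

lemma rotated_sum_deriv_bounded:
  assumes "z \<in> ball 0 1" shows "cmod (deriv rotated_sum z) \<le> 1"
proof -
  have "deriv rotated_sum z = deriv p z + \<omega> * deriv q z"
    unfolding rotated_sum_def
    by (intro DERIV_imp_deriv DERIV_add DERIV_cmult holomorphic_derivI[where S="ball 0 1"] p q assms) auto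
  then have "cmod (deriv rotated_sum z) \<le> cmod (deriv p z) + cmod (\<omega> * deriv q z)"
    by (simp only: norm_triangle_ineq)
  then show ?thesis using bound[OF assms] \<omega> by (simp add: norm_mult)
qed

lemma rotated_sum_deriv_coefficient:
  "(deriv ^^ n) (deriv rotated_sum) 0 / fact n = of_nat (Suc n) * (\<alpha> (Suc n) + \<omega> * \<beta> (Suc n))"
proof -
  have "(deriv ^^ Suc n) rotated_sum 0 / fact (Suc n) = \<alpha> (Suc n) + \<omega> * \<beta> (Suc n)"
  proof (rule Taylor_coefficient_eq_powser[where c="\<lambda>n. \<alpha> n + \<omega> * \<beta> n"])
    show "(\<lambda>n. (\<alpha> n + \<omega> * \<beta> n) * z ^ n) sums rotated_sum z" if "z \<in> ball 0 1" for z
      using sums_add[OF \<alpha>[OF that] sums_mult[OF \<beta>[OF that], of \<omega>]]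
      by (simp add: rotated_sum_def algebra_simps)
  qed
  then show ?thesis using deriv_Taylor_coefficient[of n rotated_sum] by metis
qed

lemma rotated_sum_coefficient_le:
  "real (Suc n) * cmod (\<alpha> (Suc n) + \<omega> * \<beta> (Suc n)) \<le> 1"
  using bounded_Taylor_coefficient_le_one[OF holomorphic_deriv[OF rotated_sum_holomorphic] rotated_sum_deriv_bounded, of n]
  unfolding rotated_sum_deriv_coefficient by (simp only: norm_mult norm_of_nat open_ball)

lemma rotated_sum_coefficient_rigid:
  assumes "real (Suc k) * cmod (\<alpha> (Suc k) + \<omega> * \<beta> (Suc k)) = 1" "n \<noteq> k"
  shows "\<alpha> (Suc n) + \<omega> * \<beta> (Suc n) = 0"
proof -
  have "cmod ((deriv ^^ k) (deriv rotated_sum) 0 / fact k) = 1"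
    using assms(1) unfolding rotated_sum_deriv_coefficient by (simp only: norm_mult norm_of_nat)
  from extremal_Taylor_coefficient_rigidity
      [OF holomorphic_deriv[OF rotated_sum_holomorphic open_ball] rotated_sum_deriv_bounded this assms(2)]
  show ?thesis unfolding rotated_sum_deriv_coefficient by (simp del: of_nat_Suc)
qed

end

lemma coefficients_le:
  assumes "1 \<le> n" shows "cmod (\<alpha> n) + cmod (\<beta> n) \<le> 1 / real n"
proof -
  obtain k where k: "n = Suc k" using assms by (cases n) auto
  obtain \<omega> where "cmod \<omega> = 1" "cmod (\<alpha> n + \<omega> * \<beta> n) = cmod (\<alpha> n) + cmod (\<beta> n)"
    by (rule unimodular_rotation_norm_add)
  then show ?thesis
    using rotated_sum_coefficient_le[of \<omega> k] assms by (simp add: k field_simps)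
qed

text \<open>
  Since \<open>\<beta> m\<close> vanishes by the coefficient bound, the coefficient at index \<open>m - 1\<close> is extremal for
  the derivative of \<open>p + \<omega> q\<close> whatever the unimodular \<open>\<omega>\<close>. The values \<open>\<omega> = 1\<close> and \<open>\<omega> = -1\<close> together
  annihilate every other coefficient of positive index, in both functions.
\<close>

lemma extremal:
  assumes "1 \<le> m" and ext: "cmod (\<alpha> m) = 1 / real m" and 0: "p 0 = 0" "q 0 = 0" and z: "z \<in> ball 0 1"
  shows "p z = \<alpha> m * z ^ m" "q z = 0"
proof -
  obtain k where k: "m = Suc k" using assms by (cases m) auto
  have \<beta>m: "\<beta> m = 0" using coefficients_le[OF assms(1)] ext by simp
  have rotated0: "\<alpha> n + \<omega> * \<beta> n = 0" if "cmod \<omega> = 1" "n \<noteq> m" "n \<noteq> 0" for \<omega> n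
    using rotated_sum_coefficient_rigid[OF that(1), of k "n - 1"] that ext \<beta>m k
    by (cases n) (auto simp del: of_nat_Suc)
  have \<alpha>0: "\<alpha> 0 = 0" "\<beta> 0 = 0" using \<alpha>[of 0] \<beta>[of 0] 0 by auto
  have zero: "\<alpha> n = 0 \<and> \<beta> n = 0" if "n \<noteq> m" for n
  proof (cases "n = 0")
    case False
    then show ?thesis using rotated0[of 1 n] rotated0[of "-1" n] that by (simp add: add_eq_0_iff2)
  qed (use \<alpha>0 in auto)
  have "\<alpha> n * z ^ n = (if n = m then \<alpha> m else 0) * z ^ n" for n
    using zero by auto
  then show "p z = \<alpha> m * z ^ m"
    using \<alpha>[OF z] monomial_sums[of m "\<alpha> m" z] by (simp only: sums_unique2)
  have "\<beta> n * z ^ n = 0" for n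
    using zero[of n] \<beta>m by (cases "n = m") auto
  then show "q z = 0"
    using \<beta>[OF z] by (simp only:) (metis sums_unique2 sums_zero)
qed

end

section \<open>Coefficient estimates\<close>

theorem theorem2p2:
  fixes f h g :: "complex \<Rightarrow> complex" and a b :: "nat \<Rightarrow> complex"
  assumes "f \<in> FH0"
    and "h analytic_on ball 0 1" and "g analytic_on ball 0 1"
    and "\<And>z. z \<in> ball 0 1 \<Longrightarrow> f z = h z + cnj (g z)"
    and "\<And>z. z \<in> ball 0 1 \<Longrightarrow> (\<lambda>n. a (n + 2) * z ^ (n + 2)) sums (h z - z)"
    and "\<And>z. z \<in> ball 0 1 \<Longrightarrow> (\<lambda>n. b (n + 1) * z ^ (n + 1)) sums g z"
    and "b 1 = deriv g 0" and "deriv g 0 = 0"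
  shows "(\<forall>n\<ge>2. cmod (a n) \<le> 1 / real n) \<and>
         (\<forall>m\<ge>2. cmod (a m) = 1 / real m \<longleftrightarrow>
            f analytic_on ball 0 1 \<and>
            (\<exists>c. cmod c = 1 \<and> (\<forall>z\<in>ball 0 1. f z = z + c * z ^ m / of_nat m))) \<and>
         (\<forall>n\<ge>2. cmod (b n) \<le> 1 / real n) \<and>
         (\<forall>m\<ge>2. cmod (b m) = 1 / real m \<longleftrightarrow>
            (\<exists>c. cmod c = 1 \<and> (\<forall>z\<in>ball 0 1. f z = z + c * cnj z ^ m / of_nat m))) \<and>
         (\<forall>n\<ge>2. (cmod (a n))\<^sup>2 + (cmod (b n))\<^sup>2 \<le> 1 / (real n)\<^sup>2) \<and>
         (\<forall>n\<ge>2. cmod (a n) + cmod (b n) \<le> 1 / real n)"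
proof -
  (* The hypotheses leave a 0, a 1 and b 0 unspecified; the series of p and g need zeros there. *)
  define \<alpha> where "\<alpha> = (\<lambda>n. if n < 2 then 0 else a n)"
  define \<beta> where "\<beta> = (\<lambda>n. if n < 1 then 0 else b n)"
  define p where "p = (\<lambda>z. h z - z)"
  have h: "h holomorphic_on ball 0 1" and g: "g holomorphic_on ball 0 1"
    using assms(2,3) by (auto intro: analytic_imp_holomorphic)
  have p: "p holomorphic_on ball 0 1" unfolding p_def by (intro holomorphic_intros h)
  have \<alpha>_sums: "(\<lambda>n. \<alpha> n * z ^ n) sums p z" if "z \<in> ball 0 1" for z
    using assms(5)[OF that] sums_zero_iff_shift[of 2 "\<lambda>n. \<alpha> n * z ^ n" "p z"]
    by (auto simp: \<alpha>_def p_def)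
  have \<beta>_sums: "(\<lambda>n. \<beta> n * z ^ n) sums g z" if "z \<in> ball 0 1" for z
    using assms(6)[OF that] sums_zero_iff_shift[of 1 "\<lambda>n. \<beta> n * z ^ n" "g z"]
    by (auto simp: \<beta>_def)
  have bound: "cmod (deriv p z) + cmod (deriv g z) \<le> 1" if z: "z \<in> ball 0 1" for z
  proof -
    have "dz f z = deriv h z" "dzbar f z = cnj (deriv g z)"
      using Wirtinger_derivatives_decomposition[OF open_ball z h g assms(4)] by auto
    moreover have "deriv p z = deriv h z - 1"
      unfolding p_def
      by (intro DERIV_imp_deriv DERIV_diff DERIV_ident holomorphic_derivI[OF h open_ball z])
    moreover have "cmod (dz f z - 1) < 1 - cmod (dzbar f z)"
      using assms(1) z by (simp add: FH0_def)
    ultimately show ?thesis by simp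
  qed
  interpret A: derivative_pair p g \<alpha> \<beta>
    by unfold_locales (fact p g bound \<alpha>_sums \<beta>_sums)+
  interpret B: derivative_pair g p \<beta> \<alpha>
    by (rule A.swap)
  have p0: "p 0 = 0" and g0: "g 0 = 0"
    using \<alpha>_sums[of 0] \<beta>_sums[of 0] by (auto simp: \<alpha>_def \<beta>_def)
  have coeff: "\<alpha> n = a n" "\<beta> n = b n" if "2 \<le> n" for n
    using that by (auto simp: \<alpha>_def \<beta>_def)
  have iv: "cmod (a n) + cmod (b n) \<le> 1 / real n" if "2 \<le> n" for n
    using A.coefficients_le[of n] that by (simp add: coeff)
  have iii: "(cmod (a n))\<^sup>2 + (cmod (b n))\<^sup>2 \<le> 1 / (real n)\<^sup>2" if "2 \<le> n" for n
  proof -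
    have "(cmod (a n))\<^sup>2 + (cmod (b n))\<^sup>2 \<le> (cmod (a n) + cmod (b n))\<^sup>2"
      by (simp add: power2_sum)
    also have "\<dots> \<le> (1 / real n)\<^sup>2"
      using iv[OF that] by (intro power_mono) auto
    finally show ?thesis by (simp add: power_divide)
  qed
  have i_bound: "cmod (a n) \<le> 1 / real n" and ii_bound: "cmod (b n) \<le> 1 / real n" if "2 \<le> n" for n
    using iv[OF that] norm_ge_zero[of "a n"] norm_ge_zero[of "b n"] by linarith+
  have a_eq: "cmod (a m) = 1 / real m \<longleftrightarrow>
      f analytic_on ball 0 1 \<and>
      (\<exists>c. cmod c = 1 \<and> (\<forall>z\<in>ball 0 1. f z = z + c * z ^ m / of_nat m))" if m: "2 \<le> m" for m
  proof (intro iffI conjI; (elim conjE exE)?)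
    assume ext: "cmod (a m) = 1 / real m"
    have f: "f z = z + (of_nat m * a m) * z ^ m / of_nat m" if z: "z \<in> ball 0 1" for z
    proof -
      have "p z = a m * z ^ m" "g z = 0"
        using A.extremal[of m z] m ext p0 g0 z by (simp_all add: coeff)
      then show ?thesis using assms(4)[OF z] m by (simp add: p_def algebra_simps)
    qed
    have "(\<lambda>z. z + (of_nat m * a m) * z ^ m / of_nat m) holomorphic_on ball 0 1"
      by (intro holomorphic_intros) (use m in auto)
    then have "f holomorphic_on ball 0 1"
      by (rule holomorphic_transform) (simp add: f)
    then show "f analytic_on ball 0 1" by (simp add: analytic_on_open)
    show "\<exists>c. cmod c = 1 \<and> (\<forall>z\<in>ball 0 1. f z = z + c * z ^ m / of_nat m)"
      using f ext m by (intro exI[of _ "of_nat m * a m"]) (simp add: norm_mult)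
  next
    fix c assume c: "cmod c = 1" and f: "\<forall>z\<in>ball 0 1. f z = z + c * z ^ m / of_nat m"
    have "h z = z + c * z ^ m / of_nat m" if z: "z \<in> ball 0 1" for z
      by (rule analytic_part_unique(1)[of "ball 0 1" h g _ "\<lambda>_. 0"])
        (use m h g z f assms(4) p0 in \<open>auto intro!: holomorphic_intros simp: p_def\<close>)
    then have "\<alpha> = (\<lambda>n. if n = m then c / of_nat m else 0)"
      using monomial_sums[of m "c / of_nat m"] \<alpha>_sums
      by (intro powser_unique[of _ p]) (auto simp: p_def)
    then have "a m = c / of_nat m" using coeff(1)[OF m] by (simp add: fun_eq_iff)
    then show "cmod (a m) = 1 / real m" using c by (simp add: norm_divide)
  qed
  have b_eq: "cmod (b m) = 1 / real m \<longleftrightarrow>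
      (\<exists>c. cmod c = 1 \<and> (\<forall>z\<in>ball 0 1. f z = z + c * cnj z ^ m / of_nat m))" if m: "2 \<le> m" for m
  proof (intro iffI; (elim conjE exE)?)
    assume ext: "cmod (b m) = 1 / real m"
    have "f z = z + (of_nat m * cnj (b m)) * cnj z ^ m / of_nat m" if z: "z \<in> ball 0 1" for z
    proof -
      have "g z = b m * z ^ m" "p z = 0"
        using B.extremal[of m z] m ext p0 g0 z by (simp_all add: coeff)
      then show ?thesis using assms(4)[OF z] m by (simp add: p_def)
    qed
    then show "\<exists>c. cmod c = 1 \<and> (\<forall>z\<in>ball 0 1. f z = z + c * cnj z ^ m / of_nat m)"
      using ext m by (intro exI[of _ "of_nat m * cnj (b m)"]) (simp add: norm_mult)
  next
    fix c assume c: "cmod c = 1" and f: "\<forall>z\<in>ball 0 1. f z = z + c * cnj z ^ m / of_nat m"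
    have "g z = cnj c * z ^ m / of_nat m" if z: "z \<in> ball 0 1" for z
      by (rule analytic_part_unique(2)[of "ball 0 1" h g "\<lambda>z. z"])
        (use m h g z f assms(4) p0 in \<open>auto intro!: holomorphic_intros simp: p_def\<close>)
    then have "\<beta> = (\<lambda>n. if n = m then cnj c / of_nat m else 0)"
      using monomial_sums[of m "cnj c / of_nat m"] \<beta>_sums
      by (intro powser_unique[of _ g]) auto
    then have "b m = cnj c / of_nat m" using coeff(2)[OF m] by (simp add: fun_eq_iff)
    then show "cmod (b m) = 1 / real m" using c by (simp add: norm_divide)
  qed
  show ?thesis using i_bound a_eq ii_bound b_eq iii iv by blast
qed

end
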